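(* Let $p$ be a prime number. The restriction of the function $\Psi_p$ to a map $\mathbb{Q}_p \to \mathbb{Z}_p$ is uniformly continuous. More precisely, for any $j = 0,1,2,\dots$ and any $x \in \mathbb{Q}_p$, $$\Psi_p(x + p^j \mathbb{C}_p^\circ) \subset \Psi_p(x) + p^j \mathbb{C}_p^\circ .$$
   Context: $\mathbb{C}_p$ is the completion of an algebraic closure of $\mathbb{Q}_p$, with valuation $v_p$ normalized by $v_p(p)=1$, and $\mathbb{C}_p^\circ = \{x\in\mathbb{C}_p : v_p(x)\ge 0\}$. $\Psi_p(T) \in T + T^2\mathbb{Z}[[T]]$ is the unique power series of this form satisfying $\sum_{j=0}^\infty p^{-j}\Psi_p(p^jT)^{p^j} = T$. It is $p$-adically entire (converges on all of $\mathbb{C}_p$) and satisfies $\Psi_p(\mathbb{Q}_p)\subset \mathbb{Z}_p$. *)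

theory Defs
  imports "HOL-Analysis.Analysis" "HOL-Computational_Algebra.Computational_Algebra"
begin

text \<open>
  The field \<open>\<complex>\<^sub>p\<close> is given by its characterisation up to isometric isomorphism: a field
  \<open>'a\<close> with a valuation \<open>v\<close> such that \<open>v p = 1\<close>, complete, in which the elements
  algebraic over \<open>\<rat>\<^sub>p\<close> form a dense algebraically closed subfield.
\<close>

definition valuation_normalized :: "nat \<Rightarrow> ('a::field_char_0 \<Rightarrow> ereal) \<Rightarrow> bool" where
  "valuation_normalized p v \<longleftrightarrow>
     (\<forall>x. v x \<noteq> -\<infinity>) \<and>
     (\<forall>x. v x = \<infinity> \<longleftrightarrow> x = 0) \<and>
     (\<forall>x y. v (x * y) = v x + v y) \<and>
     (\<forall>x y. min (v x) (v y) \<le> v (x + y)) \<and>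
     v (of_nat p) = 1"

definition padic_dist :: "nat \<Rightarrow> ('a::field_char_0 \<Rightarrow> ereal) \<Rightarrow> 'a \<Rightarrow> 'a \<Rightarrow> real" where
  "padic_dist p v x y = (if x = y then 0 else real p powr (- real_of_ereal (v (x - y))))"

definition padic_metric :: "nat \<Rightarrow> ('a::field_char_0 \<Rightarrow> ereal) \<Rightarrow> 'a metric" where
  "padic_metric p v = metric (UNIV, padic_dist p v)"

text \<open>
  By \<open>v p = 1\<close> (\<open>p\<close> prime), \<open>v\<close> restricts to the \<open>p\<close>-adic valuation on the prime
  field \<open>\<rat>\<close>. In a complete field the closure of \<open>\<rat>\<close> is therefore its \<open>p\<close>-adic completion.
\<close>

definition Qp :: "nat \<Rightarrow> ('a::field_char_0 \<Rightarrow> ereal) \<Rightarrow> 'a set" where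
  "Qp p v = mtopology_of (padic_metric p v) closure_of \<rat>"

definition Qp_alg :: "nat \<Rightarrow> ('a::field_char_0 \<Rightarrow> ereal) \<Rightarrow> 'a set" where
  "Qp_alg p v = {x. \<exists>f. f \<noteq> 0 \<and> (\<forall>i. coeff f i \<in> Qp p v) \<and> poly f x = 0}"

definition is_Cp :: "nat \<Rightarrow> ('a::field_char_0 \<Rightarrow> ereal) \<Rightarrow> bool" where
  "is_Cp p v \<longleftrightarrow>
     valuation_normalized p v \<and>
     mcomplete_of (padic_metric p v) \<and>
     (\<forall>f. degree f > 0 \<and> (\<forall>i. coeff f i \<in> Qp_alg p v) \<longrightarrow> (\<exists>x\<in>Qp_alg p v. poly f x = 0)) \<and>
     mtopology_of (padic_metric p v) closure_of (Qp_alg p v) = UNIV"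

definition val_ring :: "('a::field_char_0 \<Rightarrow> ereal) \<Rightarrow> 'a set" where
  "val_ring v = {x. v x \<ge> 0}"

definition Zp :: "nat \<Rightarrow> ('a::field_char_0 \<Rightarrow> ereal) \<Rightarrow> 'a set" where
  "Zp p v = Qp p v \<inter> val_ring v"

lemma Metric_space_padic_dist:
  assumes "prime p" and v: "valuation_normalized p v"
  shows "Metric_space UNIV (padic_dist p v)"
proof -
  have p: "real p > 1"
    using prime_gt_1_nat[OF assms(1)] by simp
  have v_mult: "v (x * y) = v x + v y" and v_add: "min (v x) (v y) \<le> v (x + y)"
    and v_inf: "v x = \<infinity> \<longleftrightarrow> x = 0" and v_minf: "v x \<noteq> -\<infinity>" for x y
    using v unfolding valuation_normalized_def by blast+
  have v1: "v 1 = 0"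
    using v_mult[of 1 1] v_inf[of 1] v_minf[of 1] by (cases "v 1") auto
  have "v (-1) + v (-1) = 0"
    using v_mult[of "-1" "-1"] v1 by simp
  then have "v (-1) = 0"
    using v_inf[of "-1"] v_minf[of "-1"] by (cases "v (-1)") auto
  then have v_minus: "v (- x) = v x" for x
    using v_mult[of "-1" x] by simp
  have nonneg: "0 \<le> padic_dist p v x y" for x y
    by (simp add: padic_dist_def)
  have ultra: "padic_dist p v x z \<le> max (padic_dist p v x y) (padic_dist p v y z)" for x y z
  proof (cases "x = y \<or> y = z \<or> x = z")
    case True
    then show ?thesis
      by (auto simp: padic_dist_def le_max_iff_disj)
  next
    case False
    obtain a b c where abc: "v (x - y) = ereal a" "v (y - z) = ereal b" "v (x - z) = ereal c"
      using False v_inf v_minf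
      by (metis ereal_cases eq_iff_diff_eq_0)
    have "min a b \<le> c"
      using v_add[of "x - y" "y - z"] abc by (auto simp: min_def split: if_splits)
    then show ?thesis
      using False abc p by (auto simp: padic_dist_def min_def max_def split: if_splits)
  qed
  show ?thesis
  proof
    show "padic_dist p v x y = padic_dist p v y x" for x y
      using v_minus[of "x - y"] by (auto simp: padic_dist_def)
    show "padic_dist p v x y = 0 \<longleftrightarrow> x = y" for x y
      using p by (simp add: padic_dist_def)
    show "padic_dist p v x z \<le> padic_dist p v x y + padic_dist p v y z" for x y z
      using ultra[of x z y] nonneg[of x y] nonneg[of y z] by linarith
  qed (rule nonneg)
qed

text \<open>
  The \<open>sums\<close> below is convergence in the \<open>T\<close>-adic topology of \<open>\<rat>[[T]]\<close>.
\<close>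

definition is_Psi_series :: "nat \<Rightarrow> int fps \<Rightarrow> bool" where
  "is_Psi_series p F \<longleftrightarrow>
     fps_nth F 0 = 0 \<and> fps_nth F 1 = 1 \<and>
     (\<lambda>j. fps_const (1 / of_nat p ^ j) *
          (Abs_fps (\<lambda>n. rat_of_int (fps_nth F n)) oo (fps_const (of_nat p ^ j) * fps_X)) ^ (p ^ j))
       sums (fps_X :: rat fps)"

definition Psi_series :: "nat \<Rightarrow> int fps" where
  "Psi_series p = (THE F. is_Psi_series p F)"

definition Psi :: "nat \<Rightarrow> ('a::field_char_0 \<Rightarrow> ereal) \<Rightarrow> 'a \<Rightarrow> 'a" where
  "Psi p v x =
     (THE l. limitin (mtopology_of (padic_metric p v))
        (\<lambda>n. \<Sum>k<n. of_int (fps_nth (Psi_series p) k) * x ^ k) l sequentially)"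

end

theory Submission
  imports Defs "HOL-Number_Theory.Residues"
begin

text \<open>
  Write \<open>d j = \<Psi> (p ^ j * x)\<close>. The functional equation
  \<open>x = (\<Sum>j. d j ^ p ^ j / p ^ j)\<close> holds pointwise because \<open>\<Psi>\<close> is entire, with
  bounds uniform in \<open>j\<close> on the coefficients of the summands. For \<open>x \<in> Qp\<close> both claims follow by
  induction on the least \<open>N\<close> with \<open>p ^ N * x\<close> integral, the case \<open>N = 0\<close> being that of
  a power series with integral coefficients.
  Integrality: comparing the functional equations at \<open>x\<close> and \<open>p * x\<close> gives
  \<open>\<Psi> x = (\<Sum>j\<ge>1. (d j ^ p ^ (j - 1) - d j ^ p ^ j) / p ^ j)\<close>, whose terms are integral, as
  \<open>d j \<in> Zp\<close> for \<open>j \<ge> 1\<close> by induction.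
  Lipschitz bound: if \<open>y\<close> is congruent to \<open>x\<close> modulo \<open>p ^ r\<close>, then by induction the values of
  \<open>\<Psi>\<close> at \<open>p ^ j * y\<close> and \<open>p ^ j * x\<close> are congruent modulo \<open>p ^ (r + j)\<close> for \<open>j \<ge> 1\<close>, so
  that all terms with \<open>j \<ge> 1\<close> in the difference of the two functional equations vanish modulo
  \<open>p ^ r\<close>, and hence so does the term \<open>\<Psi> y - \<Psi> x\<close> with \<open>j = 0\<close>.
\<close>

subsection \<open>The formal power series\<close>

lemma fps_power_nth_cong:
  fixes F G :: "'a::comm_ring_1 fps"
  assumes "\<And>k. k < n \<Longrightarrow> fps_nth F k = fps_nth G k" "k < n"
  shows "fps_nth (F ^ q) k = fps_nth (G ^ q) k"
  using assms(2)
proof (induction q arbitrary: k)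
  case (Suc q)
  then show ?case
    using assms(1) by (auto simp: fps_mult_nth intro!: sum.cong)
qed simp

text \<open>In \<open>F * F ^ (q - 1)\<close>, a coefficient of index \<open>n\<close> of one factor
  meets the constant coefficient of the other. Both constant coefficients vanish because
  \<open>q \<ge> 2\<close>, so only indices below \<open>n\<close> matter.\<close>

lemma fps_power_nth_cong_startsby_zero:
  fixes F G :: "'a::comm_ring_1 fps"
  assumes F: "fps_nth F 0 = 0" and G: "fps_nth G 0 = 0"
    and eq: "\<And>k. k < n \<Longrightarrow> fps_nth F k = fps_nth G k" and q: "2 \<le> q"
  shows "fps_nth (F ^ q) n = fps_nth (G ^ q) n"
proof -
  obtain r where r: "q = Suc r" "r \<noteq> 0"
    using q by (cases q) auto
  have "fps_nth F i * fps_nth (F ^ r) (n - i) = fps_nth G i * fps_nth (G ^ r) (n - i)"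
    if "i \<le> n" for i
  proof (cases "i = 0 \<or> i = n")
    case True
    then show ?thesis
      using F G r by (auto simp: fps_nth_power_0 zero_power)
  next
    case False
    then show ?thesis
      using that eq fps_power_nth_cong[of n F G "n - i" r] by auto
  qed
  then show ?thesis
    by (auto simp: r fps_mult_nth intro!: sum.cong)
qed

lemma fps_of_int_power:
  "Abs_fps (\<lambda>n. of_int (fps_nth F n)) ^ q
     = (Abs_fps (\<lambda>n. of_int (fps_nth (F ^ q) n)) :: 'a::comm_ring_1 fps)"
  by (induction q) (auto simp: fps_eq_iff fps_mult_nth)

text \<open>
  For \<open>fps_nth F 0 = 0\<close>, this is the coefficient of \<open>T ^ n\<close> in
  \<open>p ^ -j * F (p ^ j * T) ^ (p ^ j)\<close>; the truncated subtraction at \<open>n = 0\<close> is harmless as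
  the power of \<open>F\<close> vanishes there.
\<close>

definition psi_term :: "nat \<Rightarrow> int fps \<Rightarrow> nat \<Rightarrow> nat \<Rightarrow> int" where
  "psi_term p F j n = int p ^ (j * (n - 1)) * fps_nth (F ^ (p ^ j)) n"

lemma psi_term_eq_0:
  assumes "1 < p" "fps_nth F 0 = 0" "n \<le> j"
  shows "psi_term p F j n = 0"
proof -
  have "n < p ^ j"
    using assms power_gt_expt[of p j] by linarith
  then show ?thesis
    using startsby_zero_power_prefix[OF assms(2), of "p ^ j"] by (simp add: psi_term_def)
qed

lemma psi_term_0_left [simp]: "psi_term p F 0 n = fps_nth F n"
  by (simp add: psi_term_def)

text \<open>Scaling the variable gives \<open>p ^ (j * n)\<close>, and dividing by
  \<open>p ^ j\<close> leaves \<open>p ^ (j * (n - 1))\<close>. The case \<open>y = 1\<close> over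
  the rationals reads off formal coefficients; general \<open>y\<close> serves evaluation at
  points.\<close>

lemma psi_term_eq:
  fixes y :: "'a::field_char_0"
  assumes "1 < p" "fps_nth F 0 = 0"
  shows "of_int (psi_term p F j n) * y ^ n
    = (of_int (fps_nth (F ^ (p ^ j)) n) * (of_nat p ^ j * y) ^ n) / of_nat p ^ j"
proof (cases n)
  case 0
  then show ?thesis
    using assms by (simp add: psi_term_def fps_nth_power_0 zero_power)
next
  case (Suc m)
  then show ?thesis
    using assms(1) by (simp add: psi_term_def power_mult power_mult_distrib)
qed

text \<open>\<open>T\<close>-adic convergence means that each coefficient is eventually constant.
  Coefficient \<open>n\<close> of the partial sums is constant from \<open>J > n\<close> on, as
  later summands start beyond degree \<open>n\<close>, so only integer identities remain.\<close>

lemma is_Psi_series_iff: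
  assumes p: "1 < p"
  shows "is_Psi_series p F \<longleftrightarrow> fps_nth F 0 = 0 \<and> fps_nth F 1 = 1 \<and>
    (\<forall>n J. n < J \<longrightarrow> (\<Sum>j<J. psi_term p F j n) = of_bool (n = 1))"
proof -
  have "((\<lambda>j. fps_const (1 / of_nat p ^ j) *
          (Abs_fps (\<lambda>n. rat_of_int (fps_nth F n)) oo (fps_const (of_nat p ^ j) * fps_X)) ^ (p ^ j))
       sums (fps_X :: rat fps)) \<longleftrightarrow>
     (\<forall>n J. n < J \<longrightarrow> (\<Sum>j<J. psi_term p F j n) = of_bool (n = 1))"
    (is "?f sums _ \<longleftrightarrow> ?R") if F: "fps_nth F 0 = 0"
  proof -
    have nth: "fps_nth (?f j) n = of_int (psi_term p F j n)" for j n
    proof -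
      \<comment> \<open>Substitution commutes with powers, so the power is taken first, while the
        coefficients are still integers.\<close>
      have eq: "?f j = fps_const (1 / of_nat p ^ j) *
          (Abs_fps (\<lambda>n. rat_of_int (fps_nth (F ^ (p ^ j)) n)) oo (fps_const (of_nat p ^ j) * fps_X))"
        by (subst fps_compose_power) (simp_all only: fps_of_int_power, simp)
      show ?thesis
        unfolding eq unfolding fps_compose_linear
        using psi_term_eq[where 'a = rat and y = 1, OF p F, of j n]
        by (simp add: mult.commute)
    qed
    have stable: "(\<Sum>j<J. psi_term p F j n) = (\<Sum>j<Suc n. psi_term p F j n)" if "n < J" for n J
      using that by (intro sum.mono_neutral_right) (auto intro: psi_term_eq_0[OF p F])
    have "?f sums fps_X \<longleftrightarrow>
      (\<forall>n. eventually (\<lambda>J. rat_of_int (\<Sum>j<J. psi_term p F j n) = rat_of_int (of_bool (n = 1)))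
        sequentially)"
      unfolding sums_def tendsto_fps_iff fps_sum_nth nth by (simp add: fps_X_nth)
    also have "\<dots> \<longleftrightarrow>
      (\<forall>n. eventually (\<lambda>J. (\<Sum>j<J. psi_term p F j n) = of_bool (n = 1)) sequentially)"
      unfolding of_int_eq_iff by (rule refl)
    also have "\<dots> \<longleftrightarrow> (\<forall>n. (\<Sum>j<Suc n. psi_term p F j n) = of_bool (n = 1))"
    proof (intro iff_allI)
      fix n
      have "eventually (\<lambda>J. ((\<Sum>j<J. psi_term p F j n) = of_bool (n = 1))
          = ((\<Sum>j<Suc n. psi_term p F j n) = of_bool (n = 1))) sequentially"
        using eventually_gt_at_top[of n] by eventually_elim (subst stable, assumption, rule refl)
      then show "eventually (\<lambda>J. (\<Sum>j<J. psi_term p F j n) = of_bool (n = 1)) sequentially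
          \<longleftrightarrow> (\<Sum>j<Suc n. psi_term p F j n) = of_bool (n = 1)"
        by (subst eventually_subst, assumption) (rule eventually_const[OF sequentially_bot])
    qed
    also have "\<dots> \<longleftrightarrow> ?R"
      using stable lessI by (intro iffI allI impI) (auto simp del: sum.lessThan_Suc)
    finally show ?thesis .
  qed
  then show ?thesis
    unfolding is_Psi_series_def by blast
qed

text \<open>Coefficient \<open>n\<close> of the functional equation, solved for its
  \<open>j = 0\<close> term. For \<open>1 < p\<close> the other terms involve only lower
  coefficients; cutting the series off at \<open>n\<close> makes the recursion well-founded.\<close>

function psi_coeff :: "nat \<Rightarrow> nat \<Rightarrow> int" where
  "psi_coeff p n = of_bool (n = 1)
     - (\<Sum>j=1..n. psi_term p (Abs_fps (\<lambda>k. if k < n then psi_coeff p k else 0)) j n)"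
  by auto
termination by (relation "Wellfounded.measure snd") auto

declare psi_coeff.simps [simp del]

lemma psi_term_cong:
  assumes "fps_nth F 0 = 0" "fps_nth G 0 = 0" "\<And>k. k < n \<Longrightarrow> fps_nth F k = fps_nth G k"
    and "1 < p" "0 < j"
  shows "psi_term p F j n = psi_term p G j n"
proof -
  have "p ^ 1 \<le> p ^ j"
    using assms(4,5) by (intro power_increasing) auto
  then have "2 \<le> p ^ j"
    using assms(4) by simp
  then show ?thesis
    using fps_power_nth_cong_startsby_zero[OF assms(1,2,3)] by (simp add: psi_term_def)
qed

lemma sum_psi_term_split:
  assumes "1 < p" "fps_nth F 0 = 0" "n < J"
  shows "(\<Sum>j<J. psi_term p F j n) = fps_nth F n + (\<Sum>j=1..n. psi_term p F j n)"
proof -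
  have "(\<Sum>j<J. psi_term p F j n) = (\<Sum>j\<in>insert 0 {1..n}. psi_term p F j n)"
    using assms by (intro sum.mono_neutral_right) (auto intro: psi_term_eq_0)
  then show ?thesis
    by simp
qed

lemma is_Psi_series_Abs_psi_coeff:
  assumes p: "1 < p"
  shows "is_Psi_series p (Abs_fps (psi_coeff p))"
proof -
  have 0: "psi_coeff p 0 = 0"
    by (simp add: psi_coeff.simps)
  have eq: "psi_coeff p n = of_bool (n = 1) - (\<Sum>j=1..n. psi_term p (Abs_fps (psi_coeff p)) j n)" for n
    by (subst psi_coeff.simps) (use p in \<open>auto intro!: sum.cong psi_term_cong simp: 0\<close>)
  \<comment> \<open>The only possible correction to the linear coefficient vanishes, as
    \<open>F ^ p\<close> starts in degree at least \<open>p > 1\<close>.\<close>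
  have "psi_term p (Abs_fps (psi_coeff p)) 1 1 = 0"
    using 0 by (intro psi_term_eq_0[OF p]) auto
  then have "psi_coeff p 1 = 1"
    using eq[of 1] by simp
  then show ?thesis
    unfolding is_Psi_series_iff[OF p]
    using 0 eq by (auto simp: sum_psi_term_split[OF p])
qed

lemma is_Psi_series_unique:
  assumes p: "1 < p" and F: "is_Psi_series p F" and G: "is_Psi_series p G"
  shows "F = G"
proof (rule fps_ext)
  note F' = F[unfolded is_Psi_series_iff[OF p]] and G' = G[unfolded is_Psi_series_iff[OF p]]
  fix n
  show "fps_nth F n = fps_nth G n"
  proof (induction n rule: less_induct)
    case (less n)
    have "(\<Sum>j=1..n. psi_term p F j n) = (\<Sum>j=1..n. psi_term p G j n)"
      using less F' G' p by (intro sum.cong refl psi_term_cong) auto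
    moreover have "fps_nth F n + (\<Sum>j=1..n. psi_term p F j n) = of_bool (n = 1)"
      using F' sum_psi_term_split[OF p, of F n "Suc n"] by (metis lessI)
    moreover have "fps_nth G n + (\<Sum>j=1..n. psi_term p G j n) = of_bool (n = 1)"
      using G' sum_psi_term_split[OF p, of G n "Suc n"] by (metis lessI)
    ultimately show ?case
      by simp
  qed
qed

lemma is_Psi_series_Psi_series:
  assumes "1 < p"
  shows "is_Psi_series p (Psi_series p)"
  unfolding Psi_series_def
  by (rule theI) (use is_Psi_series_Abs_psi_coeff is_Psi_series_unique assms in blast)+

text \<open>The hypothesis says that \<open>c * F\<close> arises from some series by the
  substitution of \<open>b * T\<close> for \<open>T\<close>, a form that powers preserve.\<close>

lemma dvd_fps_power_nth:
  fixes F :: "'a::comm_ring_1 fps"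
  assumes "\<And>n. b ^ n dvd c * fps_nth F n"
  shows "b ^ n dvd c ^ q * fps_nth (F ^ q) n"
proof (induction q arbitrary: n)
  case 0
  then show ?case by (cases n) auto
next
  case (Suc q)
  have eq: "c ^ Suc q * fps_nth (F ^ Suc q) n
      = (\<Sum>i=0..n. (c * fps_nth F i) * (c ^ q * fps_nth (F ^ q) (n - i)))"
    by (simp add: fps_mult_nth sum_distrib_left mult_ac)
  have "b ^ n dvd (c * fps_nth F i) * (c ^ q * fps_nth (F ^ q) (n - i))"
    if "i \<le> n" for i
    using mult_dvd_mono[OF assms[of i] Suc[of "n - i"]] that by (simp flip: power_add)
  then show ?case
    unfolding eq by (intro dvd_sum) auto
qed

text \<open>
  Quantitative entireness. Passing from \<open>M\<close> to \<open>M + 1\<close>, the terms with \<open>j > M\<close> are divisible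
  enough thanks to their explicit power of \<open>p\<close>; for the finitely many \<open>1 \<le> j \<le> M\<close> the
  factor \<open>p ^ (j * (n - 1))\<close> improves the bound on the powers of \<open>F\<close>; and \<open>F\<close>
  itself is minus the sum of the other terms.
\<close>

lemma psi_term_entire:
  assumes p: "1 < p" and F: "is_Psi_series p F"
  shows "\<exists>C. \<forall>j n. int p ^ (M * n) dvd int p ^ C * psi_term p F j n"
proof (induction M)
  case 0
  show ?case by simp
next
  case (Suc M)
  note F' = F[unfolded is_Psi_series_iff[OF p]]
  from Suc obtain C where C: "int p ^ (M * n) dvd int p ^ C * psi_term p F j n" for j n
    by blast
  \<comment> \<open>\<open>Suc M\<close> pays for the exponent \<open>n - 1\<close> in place of
    \<open>n\<close> in \<open>psi_term\<close>; \<open>p ^ M * C\<close> dominates the cost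
    \<open>p ^ j * C\<close> of the powers with \<open>j \<le> M\<close>.\<close>
  define C' where "C' = Suc M + p ^ M * C"
  have pos: "int p ^ (Suc M * n) dvd int p ^ C' * psi_term p F j n" if "0 < j" for j n
  proof (cases "n = 0")
    case True
    then show ?thesis by simp
  next
    case n: False
    show ?thesis
    proof (cases "j \<le> M")
      case True
      \<comment> \<open>The instance \<open>j = 0\<close> of the induction hypothesis concerns
        \<open>F\<close> itself and is raised to the power \<open>p ^ j\<close>.\<close>
      have "(int p ^ M) ^ n dvd (int p ^ C) ^ (p ^ j) * fps_nth (F ^ (p ^ j)) n"
        using C[of _ 0] by (intro dvd_fps_power_nth) (simp add: power_mult)
      then have "int p ^ (M * n) dvd int p ^ (p ^ j * C) * fps_nth (F ^ (p ^ j)) n"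
        by (simp add: mult.commute flip: power_mult)
      then have "int p ^ (n + M * n) dvd
          int p ^ (Suc M + j * (n - 1)) * (int p ^ (p ^ M * C) * fps_nth (F ^ (p ^ j)) n)"
        unfolding power_add[of _ n]
      proof (rule mult_dvd_mono[rotated, OF dvd_trans])
        have "n - 1 \<le> j * (n - 1)"
          using that by simp
        then have "n \<le> Suc M + j * (n - 1)"
          by linarith
        then show "int p ^ n dvd int p ^ (Suc M + j * (n - 1))"
          by (rule le_imp_power_dvd)
        have "p ^ j * C \<le> p ^ M * C"
          using True p by (intro mult_right_mono power_increasing) auto
        then show "int p ^ (p ^ j * C) * fps_nth (F ^ (p ^ j)) n
            dvd int p ^ (p ^ M * C) * fps_nth (F ^ (p ^ j)) n"
          by (intro mult_dvd_mono le_imp_power_dvd) auto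
      qed
      then show ?thesis
        by (simp add: psi_term_def C'_def power_add mult_ac)
    next
      case False
      have "Suc M * (n - 1) \<le> j * (n - 1)"
        using False by (intro mult_right_mono) auto
      then have "Suc M * n \<le> C' + j * (n - 1)"
        using n by (cases n) (auto simp: C'_def)
      then have "int p ^ (Suc M * n) dvd int p ^ (C' + j * (n - 1)) * fps_nth (F ^ (p ^ j)) n"
        by (intro dvd_mult2 le_imp_power_dvd)
      then show ?thesis
        by (simp add: psi_term_def power_add mult_ac)
    qed
  qed
  have "int p ^ (Suc M * n) dvd int p ^ C' * psi_term p F 0 n" for n
  proof -
    have "fps_nth F n = of_bool (n = 1) - (\<Sum>j=1..n. psi_term p F j n)"
      using F' sum_psi_term_split[OF p, of F n "Suc n"] by (metis add_diff_cancel_right' lessI)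
    then have "int p ^ C' * psi_term p F 0 n
        = int p ^ C' * of_bool (n = 1) - (\<Sum>j=1..n. int p ^ C' * psi_term p F j n)"
      by (simp add: right_diff_distrib sum_distrib_left)
    moreover have "int p ^ (Suc M * n) dvd int p ^ C' * of_bool (n = 1)"
      by (auto simp: C'_def intro!: le_imp_power_dvd dvd_mult2)
    moreover have "int p ^ (Suc M * n) dvd (\<Sum>j=1..n. int p ^ C' * psi_term p F j n)"
      using pos by (intro dvd_sum) auto
    ultimately show ?thesis
      by (simp only: dvd_diff)
  qed
  with pos show ?case
    by (metis neq0_conv)
qed

subsection \<open>Valuations and limits\<close>

locale padic_valued =
  fixes p :: nat and v :: "'a::field_char_0 \<Rightarrow> ereal"
  assumes prime: "prime p" and normalized: "valuation_normalized p v"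
    and complete: "mcomplete_of (padic_metric p v)"
begin

lemma p_gt_1: "1 < p"
  using prime by (rule prime_gt_1_nat)

sublocale Metric_space UNIV "padic_dist p v"
  by (rule Metric_space_padic_dist[OF prime normalized])

text \<open>Real lower bounds avoid arithmetic with the value \<infinity> at 0 and turn the
  valuation axioms into closure rules for balls around 0.\<close>

definition vge :: "real \<Rightarrow> 'a \<Rightarrow> bool" where
  "vge r x \<longleftrightarrow> ereal r \<le> v x"

lemma v_mult: "v (x * y) = v x + v y"
  and v_add: "min (v x) (v y) \<le> v (x + y)"
  and v_eq_infinity: "v x = \<infinity> \<longleftrightarrow> x = 0"
  and v_not_minus_infinity: "v x \<noteq> -\<infinity>"
  and v_p: "v (of_nat p) = 1"
  using normalized unfolding valuation_normalized_def by blast+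

lemma v_real: "x \<noteq> 0 \<Longrightarrow> \<exists>r. v x = ereal r"
  using v_eq_infinity[of x] v_not_minus_infinity[of x] by (cases "v x") auto

lemma v_1: "v 1 = 0"
  using v_mult[of 1 1] v_real[of 1] by auto

lemma vge_0 [simp]: "vge r 0"
  using v_eq_infinity[of 0] by (simp add: vge_def)

lemma vge_1 [simp]: "vge 0 1"
  by (simp add: vge_def v_1)

lemma vge_mono: "vge r x \<Longrightarrow> s \<le> r \<Longrightarrow> vge s x"
  by (auto simp: vge_def intro: order_trans[of "ereal s" "ereal r"])

lemma vge_add: "vge r x \<Longrightarrow> vge r y \<Longrightarrow> vge r (x + y)"
  using v_add[of x y] by (auto simp: vge_def min_def split: if_splits)

lemma vge_mult: "vge r x \<Longrightarrow> vge s y \<Longrightarrow> vge (r + s) (x * y)"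
  unfolding vge_def v_mult plus_ereal.simps(1)[symmetric] by (rule add_mono)

lemma vge_mult_left: "vge 0 x \<Longrightarrow> vge r y \<Longrightarrow> vge r (x * y)"
  using vge_mult[of 0 x r y] by simp

lemma vge_uminus: "vge r x \<Longrightarrow> vge r (- x)"
proof -
  have "v (-1) + v (-1) = 0"
    using v_mult[of "-1" "-1"] v_1 by simp
  then have "v (-1) = 0"
    using v_real[of "-1"] by auto
  then show "vge r x \<Longrightarrow> vge r (- x)"
    using v_mult[of "-1" x] by (simp add: vge_def)
qed

lemma vge_diff: "vge r x \<Longrightarrow> vge r y \<Longrightarrow> vge r (x - y)"
  using vge_add[of r x "- y"] vge_uminus by simp

lemma vge_minus_commute: "vge r (x - y) \<longleftrightarrow> vge r (y - x)"
  using vge_uminus[of r "x - y"] vge_uminus[of r "y - x"] by auto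

lemma vge_sum: "(\<And>i. i \<in> I \<Longrightarrow> vge r (f i)) \<Longrightarrow> vge r (sum f I)"
  by (induction I rule: infinite_finite_induct) (auto intro: vge_add)

lemma vge_power: "vge 0 x \<Longrightarrow> vge 0 (x ^ n)"
  by (induction n) (auto intro: vge_mult_left)

lemma vge_power_real: "vge r x \<Longrightarrow> vge (real n * r) (x ^ n)"
  by (induction n) (auto simp: algebra_simps dest: vge_mult)

lemma vge_of_nat: "vge 0 (of_nat n)"
  by (induction n) (auto intro: vge_add)

lemma vge_of_int: "vge 0 (of_int m)"
  by (cases m rule: int_cases2) (auto intro: vge_of_nat vge_uminus)

lemma v_p_power: "v (of_nat p ^ k) = ereal (real k)"
  by (induction k) (auto simp: v_1 v_mult v_p one_ereal_def zero_ereal_def)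

lemma vge_p_power_mult: "vge r (of_nat p ^ k * x) \<longleftrightarrow> vge (r - real k) x"
  by (cases "v x") (auto simp: vge_def v_mult v_p_power)

lemma vge_divide_p_power: "vge r (x / of_nat p ^ k) \<longleftrightarrow> vge (r + real k) x"
proof -
  have "of_nat p ^ k \<noteq> (0::'a)"
    using p_gt_1 by simp
  then have "x = of_nat p ^ k * (x / of_nat p ^ k)"
    by simp
  then show ?thesis
    using vge_p_power_mult[of "r + real k" k "x / of_nat p ^ k"] by simp
qed

lemma ex_vge: "\<exists>r. vge r x"
  by (cases "v x") (auto simp: vge_def v_not_minus_infinity)

lemma not_vge_1: "\<not> vge 1 1"
  by (simp add: vge_def v_1)

lemma vge_of_int_dvd:
  assumes "int p ^ k dvd m"
  shows "vge (real k) (of_int m)"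
proof -
  obtain c where "m = int p ^ k * c"
    using assms by blast
  then show ?thesis
    by (simp add: vge_p_power_mult vge_of_int)
qed

lemma padic_dist_le_iff: "padic_dist p v x y \<le> real p powr (- r) \<longleftrightarrow> vge r (x - y)"
proof (cases "x = y")
  case False
  then obtain a where "v (x - y) = ereal a"
    using v_real[of "x - y"] by auto
  then show ?thesis
    using False p_gt_1 by (simp add: padic_dist_def vge_def)
qed (simp add: padic_dist_def)

lemma ex_powr_less:
  assumes "0 < e"
  shows "\<exists>k::nat. real p powr (- real k) < e"
proof -
  have "((1 / real p) ^ k) = real p powr (- real k)" for k
    using p_gt_1 by (simp add: powr_minus powr_realpow power_one_over inverse_eq_divide)
  then show ?thesis
    using real_arch_pow_inv[OF assms, of "1 / real p"] p_gt_1 by auto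
qed

section \<open>Convergence in terms of the valuation\<close>

definition vlim :: "(nat \<Rightarrow> 'a) \<Rightarrow> 'a \<Rightarrow> bool" where
  "vlim s l \<longleftrightarrow> (\<forall>r. eventually (\<lambda>n. vge r (s n - l)) sequentially)"

lemma limitin_iff_vlim:
  "limitin (mtopology_of (padic_metric p v)) s l sequentially \<longleftrightarrow> vlim s l"
proof -
  have "(\<forall>e>0. eventually (\<lambda>n. padic_dist p v (s n) l < e) sequentially) \<longleftrightarrow> vlim s l"
  proof safe
    assume *: "\<forall>e>0. eventually (\<lambda>n. padic_dist p v (s n) l < e) sequentially"
    show "vlim s l"
      unfolding vlim_def
    proof
      fix r
      show "eventually (\<lambda>n. vge r (s n - l)) sequentially"
        using *[rule_format, of "real p powr (- r)"] p_gt_1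
        by (auto elim!: eventually_mono simp flip: padic_dist_le_iff)
    qed
  next
    fix e :: real
    assume "vlim s l" "0 < e"
    obtain k where k: "real p powr (- real k) < e"
      using ex_powr_less[OF \<open>0 < e\<close>] by blast
    have "eventually (\<lambda>n. vge (real k) (s n - l)) sequentially"
      using \<open>vlim s l\<close> by (simp add: vlim_def)
    then show "eventually (\<lambda>n. padic_dist p v (s n) l < e) sequentially"
      unfolding padic_dist_le_iff[symmetric] by eventually_elim (use k in linarith)
  qed
  then show ?thesis
    by (simp add: padic_metric_def limitin_metric)
qed

lemma vlim_unique: "vlim s l \<Longrightarrow> vlim s l' \<Longrightarrow> l = l'"
  using limitin_metric_unique[of s l sequentially l']
  by (simp add: padic_metric_def flip: limitin_iff_vlim)

text \<open>Balls are closed: \<open>l = s n - (s n - l)\<close>, and both parts eventually lie in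
  the ball. This carries estimates from partial sums to their limits.\<close>

lemma vlim_vge:
  assumes "vlim s l" "eventually (\<lambda>n. vge r (s n)) sequentially"
  shows "vge r l"
proof -
  have "eventually (\<lambda>n. vge r (s n - l)) sequentially"
    using assms(1) by (simp add: vlim_def)
  with assms(2) have "eventually (\<lambda>n. vge r l) sequentially"
    by eventually_elim (use vge_diff in fastforce)
  then show ?thesis
    by simp
qed

lemma vlim_Suc:
  assumes "vlim s l"
  shows "vlim (\<lambda>n. s (Suc n)) l"
  using assms eventually_sequentially_Suc[of "\<lambda>n. vge _ (s n - l)"] by (simp add: vlim_def)

lemma vlim_const: "vlim (\<lambda>_. c) c"
  by (simp add: vlim_def)

lemma vlim_diff:
  assumes "vlim s a" "vlim t b"
  shows "vlim (\<lambda>n. s n - t n) (a - b)"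
  unfolding vlim_def
proof
  fix r
  have "eventually (\<lambda>n. vge r (s n - a)) sequentially" "eventually (\<lambda>n. vge r (t n - b)) sequentially"
    using assms by (auto simp: vlim_def)
  then show "eventually (\<lambda>n. vge r (s n - t n - (a - b))) sequentially"
  proof eventually_elim
    case (elim n)
    then show ?case
      using vge_diff[of r "s n - a" "t n - b"] by (simp add: algebra_simps)
  qed
qed

lemma vlim_mult:
  assumes "vlim s a" "vlim t b"
  shows "vlim (\<lambda>n. s n * t n) (a * b)"
  unfolding vlim_def
proof
  fix r
  obtain \<alpha> \<beta> where \<alpha>: "vge \<alpha> a" and \<beta>: "vge \<beta> b"
    using ex_vge by blast
  \<comment> \<open>This condition makes \<alpha> a lower bound for \<open>v (s n)\<close> as well,
    which the summand \<open>s n * (t n - b)\<close> needs.\<close>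
  have "eventually (\<lambda>n. vge \<alpha> (s n - a)) sequentially"
    "eventually (\<lambda>n. vge (r - \<beta>) (s n - a)) sequentially"
    "eventually (\<lambda>n. vge (r - \<alpha>) (t n - b)) sequentially"
    using assms by (auto simp: vlim_def)
  then show "eventually (\<lambda>n. vge r (s n * t n - a * b)) sequentially"
  proof eventually_elim
    case (elim n)
    have "vge \<alpha> (s n)"
      using vge_add[OF elim(1) \<alpha>] by simp
    then have "vge r (s n * (t n - b))"
      using vge_mult[of \<alpha> "s n" "r - \<alpha>" "t n - b"] elim(3) by simp
    moreover have "vge r ((s n - a) * b)"
      using vge_mult[OF elim(2) \<beta>] by simp
    ultimately show ?case
      using vge_add[of r "s n * (t n - b)" "(s n - a) * b"] by (simp add: algebra_simps)
  qed
qed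

text \<open>By the ultrametric inequality a block of terms is no larger than its largest term, so
  terms tending to 0 give Cauchy partial sums.\<close>

lemma vlim_summable:
  assumes "\<And>r. eventually (\<lambda>n. vge r (f n)) sequentially"
  shows "\<exists>l. vlim (\<lambda>n. \<Sum>k<n. f k) l"
proof -
  define S where "S = (\<lambda>n. \<Sum>k<n. f k)"
  have "MCauchy S"
    unfolding MCauchy_def
  proof (intro conjI allI impI)
    fix e :: real
    assume "0 < e"
    then obtain k where k: "real p powr (- real k) < e"
      using ex_powr_less by blast
    obtain N where N: "\<And>n. N \<le> n \<Longrightarrow> vge (real k) (f n)"
      using assms[of "real k"] by (auto simp: eventually_sequentially)
    have le: "padic_dist p v (S n) (S m) < e" if "N \<le> m" "m \<le> n" for m n
    proof -
      have "S n = S m + (\<Sum>k=m..<n. f k)"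
        unfolding S_def using that sum.atLeastLessThan_concat[of 0 m n f]
        by (simp add: atLeast0LessThan)
      moreover have "vge (real k) (\<Sum>k=m..<n. f k)"
        using that N by (intro vge_sum) auto
      ultimately have "padic_dist p v (S n) (S m) \<le> real p powr (- real k)"
        unfolding padic_dist_le_iff by simp
      with k show ?thesis
        by simp
    qed
    show "\<exists>N. \<forall>n n'. N \<le> n \<longrightarrow> N \<le> n' \<longrightarrow> padic_dist p v (S n) (S n') < e"
    proof (intro exI allI impI)
      fix m n
      assume "N \<le> m" "N \<le> n"
      then show "padic_dist p v (S m) (S n) < e"
        using le[of m n] le[of n m] commute[of "S m" "S n"] by (cases "m \<le> n") auto
    qed
  qed simp
  then obtain l where "limitin mtopology S l sequentially"
    using complete unfolding padic_metric_def by (auto simp: mcomplete_def)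
  then show ?thesis
    unfolding S_def[symmetric]
    by (auto simp: padic_metric_def simp flip: limitin_iff_vlim)
qed

subsection \<open>The closure of the rationals\<close>

lemma Qp_iff: "x \<in> Qp p v \<longleftrightarrow> (\<forall>r. \<exists>q\<in>\<rat>. vge r (x - q))"
proof -
  have "x \<in> Qp p v \<longleftrightarrow> (\<forall>e>0. \<exists>q\<in>\<rat>. padic_dist p v x q \<le> e)"
    by (simp add: Qp_def padic_metric_def metric_closure_of_alt)
  also have "\<dots> \<longleftrightarrow> (\<forall>r. \<exists>q\<in>\<rat>. vge r (x - q))"
  proof safe
    fix r
    assume "\<forall>e>0. \<exists>q\<in>\<rat>. padic_dist p v x q \<le> e"
    moreover have "0 < real p powr (- r)"
      using p_gt_1 by simp
    ultimately show "\<exists>q\<in>\<rat>. vge r (x - q)"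
      by (meson padic_dist_le_iff)
  next
    fix e :: real
    assume *: "\<forall>r. \<exists>q\<in>\<rat>. vge r (x - q)" and "0 < e"
    then obtain k where k: "real p powr (- real k) < e"
      using ex_powr_less by blast
    obtain q where "q \<in> \<rat>" "vge (real k) (x - q)"
      using * by blast
    with k show "\<exists>q\<in>\<rat>. padic_dist p v x q \<le> e"
      by (meson less_imp_le order_trans padic_dist_le_iff)
  qed
  finally show ?thesis .
qed

lemma Rats_subset_Qp: "q \<in> \<rat> \<Longrightarrow> q \<in> Qp p v"
  unfolding Qp_iff by (metis diff_self vge_0)

lemma Qp_add: "x + y \<in> Qp p v" if xy: "x \<in> Qp p v" "y \<in> Qp p v"
  unfolding Qp_iff
proof
  fix r
  obtain a b where ab: "a \<in> \<rat>" "b \<in> \<rat>" "vge r (x - a)" "vge r (y - b)"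
    using xy unfolding Qp_iff by meson
  then have "vge r (x + y - (a + b))"
    using vge_add[of r "x - a" "y - b"] by (simp add: algebra_simps)
  then show "\<exists>q\<in>\<rat>. vge r (x + y - q)"
    using ab Rats_add by blast
qed

lemma Qp_mult: "x * y \<in> Qp p v" if xy: "x \<in> Qp p v" "y \<in> Qp p v"
  unfolding Qp_iff
proof
  fix r
  obtain \<alpha> where \<alpha>: "vge \<alpha> x"
    using ex_vge by blast
  obtain b where b: "b \<in> \<rat>" "vge (r - \<alpha>) (y - b)"
    using xy unfolding Qp_iff by meson
  obtain \<beta> where \<beta>: "vge \<beta> b"
    using ex_vge by blast
  obtain a where a: "a \<in> \<rat>" "vge (r - \<beta>) (x - a)"
    using xy unfolding Qp_iff by meson
  have "vge r (x * y - a * b)"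
    using vge_mult[OF \<alpha> b(2)] vge_mult[OF \<beta> a(2)]
      vge_add[of r "x * (y - b)" "b * (x - a)"] by (simp add: algebra_simps)
  then show "\<exists>q\<in>\<rat>. vge r (x * y - q)"
    using a b Rats_mult by blast
qed

lemma Qp_power: "x \<in> Qp p v \<Longrightarrow> x ^ n \<in> Qp p v"
  by (induction n) (auto intro: Qp_mult Rats_subset_Qp)

lemma Qp_sum: "(\<And>i. i \<in> I \<Longrightarrow> f i \<in> Qp p v) \<Longrightarrow> sum f I \<in> Qp p v"
  by (induction I rule: infinite_finite_induct) (auto intro: Qp_add Rats_subset_Qp)

lemma Qp_vlim:
  assumes "vlim s l" "\<And>n. s n \<in> Qp p v"
  shows "l \<in> Qp p v"
  unfolding Qp_iff
proof
  fix r
  have "eventually (\<lambda>n. vge r (s n - l)) sequentially"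
    using assms by (auto simp: vlim_def)
  then obtain n where n: "vge r (s n - l)"
    by (auto simp: eventually_sequentially)
  obtain q where q: "q \<in> \<rat>" "vge r (s n - q)"
    using assms(2)[of n] unfolding Qp_iff by blast
  have "vge r (l - q)"
    using vge_diff[OF q(2) n] by simp
  with q show "\<exists>q\<in>\<rat>. vge r (l - q)"
    by blast
qed

text \<open>If \<open>p\<close> divided \<open>b\<close>, then \<open>a = (a / b) * b\<close> would
  have valuation at least 1 too, and a Bezout identity would give the same for 1.\<close>

lemma coprime_denominator_of_vge:
  assumes "coprime a b" "vge 0 (of_int a / of_int b)" "b \<noteq> 0"
  shows "coprime b (int p)"
proof (rule ccontr)
  assume "\<not> coprime b (int p)"
  then have "int p dvd b"
    using prime prime_imp_coprime[of "int p" b] by (auto simp: coprime_commute)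
  then have b: "vge 1 (of_int b)"
    using vge_of_int_dvd[of 1 b] by simp
  then have "vge 1 (of_int a)"
    using vge_mult_left[OF assms(2) b] assms(3) by simp
  moreover obtain x y where "x * a + y * b = 1"
    using bezout_int[of a b] assms(1) by (auto simp: coprime_iff_gcd_eq_1)
  then have "of_int x * of_int a + of_int y * of_int b = (1::'a)"
    by (metis of_int_1 of_int_add of_int_mult)
  ultimately have "vge 1 1"
    using b by (metis vge_add vge_mult_left vge_of_int)
  then show False
    using not_vge_1 by blast
qed

lemma Rats_mod_p:
  assumes "q \<in> \<rat>" "vge 0 q"
  shows "\<exists>m. vge 1 (q - of_int m)"
proof -
  from assms(1) obtain a b where ab: "0 < b" "coprime a b" "q = of_int a / of_int b"
    by (cases rule: Rats_cases') auto
  with assms(2) have "coprime b (int p)"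
    using coprime_denominator_of_vge[of a b] by simp
  \<comment> \<open>With \<open>c\<close> inverse to \<open>b\<close> modulo \<open>p\<close>, the
    integer \<open>a * c\<close> represents \<open>a / b\<close>.\<close>
  then obtain c where "[b * c = 1] (mod int p)"
    using cong_solve_coprime_int by blast
  then have "int p ^ 1 dvd 1 - b * c"
    by (simp add: cong_iff_dvd_diff dvd_diff_commute)
  then have "vge 1 (of_int (1 - b * c))"
    using vge_of_int_dvd by fastforce
  then have "vge 1 (q * of_int (1 - b * c))"
    using vge_mult_left assms(2) by blast
  also have "q * of_int (1 - b * c) = q - of_int (a * c)"
    using ab by (simp add: algebra_simps)
  finally show ?thesis
    by blast
qed

section \<open>Fermat congruences for p-th powers\<close>

lemma fermat_int: "int p dvd m ^ p - m"
proof -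
  define n where "n = nat (m mod int p)"
  have n: "[m = int n] (mod int p)"
    using p_gt_1 by (simp add: n_def cong_def)
  have "[n ^ p = n] (mod p)"
  proof (cases "p dvd n")
    case True
    then have "p dvd n ^ p"
      using p_gt_1 by (simp add: dvd_power_le prime_dvd_power_iff[OF prime])
    with True show ?thesis
      by (simp add: cong_def)
  next
    case False
    have "[n ^ (p - 1) * n = 1 * n] (mod p)"
      by (intro cong_mult fermat_theorem prime False cong_refl)
    then show ?thesis
      using p_gt_1 by (simp flip: power_Suc2)
  qed
  then have "[int n ^ p = int n] (mod int p)"
    by (metis cong_int_iff of_nat_power)
  then have "[m ^ p = m] (mod int p)"
    using n by (meson cong_pow cong_sym cong_trans)
  then show ?thesis
    by (simp add: cong_iff_dvd_diff)
qed

lemma vge_power_diff: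
  assumes "vge 0 a" "vge 0 b" "vge r (a - b)"
  shows "vge r (a ^ n - b ^ n)"
proof -
  have "vge 0 (\<Sum>i<n. b ^ (n - Suc i) * a ^ i)"
    using assms by (intro vge_sum vge_mult_left vge_power)
  then show ?thesis
    unfolding power_diff_sumr2 using vge_mult[OF assms(3)] by fastforce
qed

text \<open>The cofactor of \<open>a - b\<close> in \<open>a ^ p - b ^ p\<close> has
  \<open>p\<close> summands, all congruent to \<open>b ^ (p - 1)\<close> modulo \<open>p\<close>
  since \<open>r \<ge> 1\<close>. Hence it is divisible by \<open>p\<close>, which gains one unit of
  precision.\<close>

lemma vge_power_p_diff:
  assumes "vge 0 a" "vge 0 b" "vge r (a - b)" "1 \<le> r"
  shows "vge (r + 1) (a ^ p - b ^ p)"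
proof -
  let ?s = "\<Sum>i<p. b ^ (p - Suc i) * a ^ i"
  have "?s = of_nat p * b ^ (p - 1) + (\<Sum>i<p. b ^ (p - Suc i) * (a ^ i - b ^ i))"
  proof -
    have "(\<Sum>i<p. b ^ (p - Suc i) * b ^ i) = (\<Sum>i<p. b ^ (p - 1))"
      by (intro sum.cong) (auto simp flip: power_add)
    then show ?thesis
      by (simp add: right_diff_distrib sum_subtractf)
  qed
  moreover have "vge 1 (of_nat p * b ^ (p - 1))"
    using vge_p_power_mult[of 1 1 "b ^ (p - 1)"] vge_power[OF assms(2)] by simp
  moreover have "vge 1 (\<Sum>i<p. b ^ (p - Suc i) * (a ^ i - b ^ i))"
    using assms vge_mono by (intro vge_sum vge_mult_left vge_power vge_power_diff) auto
  ultimately have "vge 1 ?s"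
    by (simp add: vge_add)
  then show ?thesis
    unfolding power_diff_sumr2 using vge_mult[OF assms(3)] by blast
qed

text \<open>The residue field of \<open>Qp p v\<close> is the prime field, so Fermat's little theorem applies.\<close>

lemma vge_Qp_power_p:
  assumes "x \<in> Qp p v" "vge 0 x"
  shows "vge 1 (x ^ p - x)"
proof -
  obtain q where q: "q \<in> \<rat>" "vge 1 (x - q)"
    using assms(1) unfolding Qp_iff by blast
  have "vge 0 q"
    using vge_diff[OF assms(2) vge_mono[OF q(2), of 0]] by simp
  then obtain m where m: "vge 1 (q - of_int m)"
    using Rats_mod_p[OF q(1)] by auto
  have xm: "vge 1 (x - of_int m)"
    using vge_add[OF q(2) m] by simp
  have "vge 1 (x ^ p - of_int m ^ p)"
    using vge_power_diff[OF assms(2) vge_of_int xm] .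
  moreover have "vge 1 (of_int m ^ p - of_int m)"
    using vge_of_int_dvd[of 1 "m ^ p - m"] fermat_int by simp
  ultimately have "vge 1 ((x ^ p - of_int m ^ p) + (of_int m ^ p - of_int m) - (x - of_int m))"
    using xm by (blast intro: vge_diff[OF vge_add])
  then show ?thesis
    by simp
qed

text \<open>Fermat's congruence starts the induction, and each further p-th power gains one unit of
  precision.\<close>

lemma vge_Qp_power_p_power:
  assumes "x \<in> Qp p v" "vge 0 x"
  shows "vge (real (Suc j)) (x ^ (p ^ Suc j) - x ^ (p ^ j))"
proof (induction j)
  case 0
  then show ?case
    using vge_Qp_power_p[OF assms] by simp
next
  case (Suc j)
  have "vge (real (Suc j) + 1) ((x ^ (p ^ Suc j)) ^ p - (x ^ (p ^ j)) ^ p)"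
    using Suc assms by (intro vge_power_p_diff vge_power) auto
  then show ?case
    by (simp add: mult.commute add.commute flip: power_mult)
qed

subsection \<open>Evaluation of power series\<close>

text \<open>
  The partial sums of the Cauchy product differ from the products of the partial sums by
  terms of total index at least \<open>n\<close>.
\<close>

lemma vlim_fps_mult:
  assumes F: "vlim (\<lambda>n. \<Sum>k<n. of_int (fps_nth F k) * y ^ k) a"
      "\<And>k. vge (real k - C) (of_int (fps_nth F k) * y ^ k)"
    and G: "vlim (\<lambda>n. \<Sum>k<n. of_int (fps_nth G k) * y ^ k) b"
      "\<And>k. vge (real k - D) (of_int (fps_nth G k) * y ^ k)"
  shows "vlim (\<lambda>n. \<Sum>k<n. of_int (fps_nth (F * G) k) * y ^ k) (a * b)"
    and "vge (real k - (C + D)) (of_int (fps_nth (F * G) k) * y ^ k)"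
proof -
  define f where "f k = of_int (fps_nth F k) * y ^ k" for k
  define g where "g k = of_int (fps_nth G k) * y ^ k" for k
  have fg: "of_int (fps_nth (F * G) k) * y ^ k = (\<Sum>i\<le>k. f i * g (k - i))" for k
  proof -
    have "f i * g (k - i) = of_int (fps_nth F i * fps_nth G (k - i)) * y ^ k" if "i \<le> k" for i
      using that power_add[of y i "k - i"] by (simp add: f_def g_def mult_ac)
    then show ?thesis
      by (simp add: fps_mult_nth atLeast0AtMost sum_distrib_right)
  qed
  have bound: "vge (real (i + j) - (C + D)) (f i * g j)" for i j
    using vge_mult[OF F(2)[of i] G(2)[of j]] by (simp add: f_def g_def algebra_simps)
  show "vge (real k - (C + D)) (of_int (fps_nth (F * G) k) * y ^ k)"
    unfolding fg by (intro vge_sum) (metis atMost_iff bound le_add_diff_inverse)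
  let ?prod = "\<lambda>n. (\<Sum>i<n. f i) * (\<Sum>j<n. g j)"
  have diff: "vge (real n - (C + D)) (?prod n - (\<Sum>k<n. \<Sum>i\<le>k. f i * g (k - i)))" for n
  proof -
    let ?A = "{..<n} \<times> {..<n}" and ?B = "{(i, j). i + j < n}"
    have "?B \<subseteq> ?A"
      by auto
    have "?prod n - (\<Sum>k<n. \<Sum>i\<le>k. f i * g (k - i))
        = (\<Sum>(i, j)\<in>?A. f i * g j) - (\<Sum>(i, j)\<in>?B. f i * g j)"
      by (simp add: sum_product sum.cartesian_product sum.triangle_reindex)
    also have "\<dots> = (\<Sum>(i, j)\<in>?A - ?B. f i * g j)"
      by (rule sum_diff[symmetric]) (use \<open>?B \<subseteq> ?A\<close> in auto)
    also have "vge (real n - (C + D)) \<dots>"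
      by (intro vge_sum) (auto intro!: vge_mono[OF bound])
    finally show ?thesis .
  qed
  have "vlim (\<lambda>n. ?prod n - (\<Sum>k<n. \<Sum>i\<le>k. f i * g (k - i))) 0"
    unfolding vlim_def
  proof
    fix r
    obtain N where N: "r + (C + D) \<le> real N"
      using real_arch_simple by blast
    have "eventually (\<lambda>n. N \<le> n) sequentially"
      by (rule eventually_ge_at_top)
    then show "eventually (\<lambda>n. vge r (?prod n - (\<Sum>k<n. \<Sum>i\<le>k. f i * g (k - i)) - 0)) sequentially"
    proof eventually_elim
      case (elim n)
      then show ?case
        using vge_mono[OF diff[of n], of r] N by simp
    qed
  qed
  moreover have "vlim ?prod (a * b)"
    using F(1) G(1) unfolding f_def g_def by (rule vlim_mult)
  ultimately have "vlim (\<lambda>n. ?prod n - (?prod n - (\<Sum>k<n. \<Sum>i\<le>k. f i * g (k - i)))) (a * b - 0)"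
    by (intro vlim_diff)
  then show "vlim (\<lambda>n. \<Sum>k<n. of_int (fps_nth (F * G) k) * y ^ k) (a * b)"
    by (simp add: fg)
qed

lemma vlim_fps_power:
  assumes F: "vlim (\<lambda>n. \<Sum>k<n. of_int (fps_nth F k) * y ^ k) a"
      "\<And>k. vge (real k - C) (of_int (fps_nth F k) * y ^ k)"
  shows "vlim (\<lambda>n. \<Sum>k<n. of_int (fps_nth (F ^ q) k) * y ^ k) (a ^ q)"
proof -
  \<comment> \<open>The induction carries a linear bound along because the next Cauchy product
    requires it; its constant \<open>D\<close> may depend on \<open>q\<close>.\<close>
  have "vlim (\<lambda>n. \<Sum>k<n. of_int (fps_nth (F ^ q) k) * y ^ k) (a ^ q)
    \<and> (\<exists>D. \<forall>k. vge (real k - D) (of_int (fps_nth (F ^ q) k) * y ^ k))"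
  proof (induction q)
    case 0
    have "eventually (\<lambda>n. (\<Sum>k<n. of_int (fps_nth 1 k) * y ^ k) = 1) sequentially"
      using eventually_gt_at_top[of 0]
    proof eventually_elim
      case (elim n)
      have "(\<Sum>k<n. of_int (fps_nth 1 k) * y ^ k) = (\<Sum>k\<in>{0}. of_int (fps_nth 1 k) * y ^ k)"
        using elim by (intro sum.mono_neutral_right) auto
      then show ?case
        by simp
    qed
    then have "vlim (\<lambda>n. \<Sum>k<n. of_int (fps_nth 1 k) * y ^ k) 1"
      unfolding vlim_def by (auto elim: eventually_mono)
    moreover have "vge (real k - 0) (of_int (fps_nth 1 k) * y ^ k)" for k
      by (cases "k = 0") auto
    ultimately show ?case
      unfolding power_0 by blast
  next
    case (Suc q)
    then obtain D where D: "\<And>k. vge (real k - D) (of_int (fps_nth (F ^ q) k) * y ^ k)"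
      by blast
    show ?case
      using vlim_fps_mult[OF F conjunct1[OF Suc] D] by auto
  qed
  then show ?thesis ..
qed

section \<open>The function Psi and its pointwise functional equation\<close>

lemma Psi_series_nth_0: "fps_nth (Psi_series p) 0 = 0"
  and sum_psi_term: "n < J \<Longrightarrow> (\<Sum>j<J. psi_term p (Psi_series p) j n) = of_bool (n = 1)"
  using is_Psi_series_Psi_series[OF p_gt_1] unfolding is_Psi_series_iff[OF p_gt_1] by auto

lemma vge_psi_term:
  "\<exists>C. \<forall>j k. vge (real k - C) (of_int (psi_term p (Psi_series p) j k) * x ^ k)"
proof -
  obtain w where w: "vge w x"
    using ex_vge by blast
  \<comment> \<open>With \<open>M + w \<ge> 1\<close>, divisibility of the coefficients outweighs
    the growth of \<open>x ^ k\<close> by at least \<open>k\<close>, up to a constant independent of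
    \<open>j\<close>.\<close>
  obtain M where M: "1 - w \<le> real M"
    using real_arch_simple by blast
  obtain C where C: "\<And>j n. int p ^ (M * n) dvd int p ^ C * psi_term p (Psi_series p) j n"
    using psi_term_entire[OF p_gt_1 is_Psi_series_Psi_series[OF p_gt_1]] by blast
  have "vge (real k - real C) (of_int (psi_term p (Psi_series p) j k) * x ^ k)" for j k
  proof -
    have "vge (real (M * k) - real C) (of_int (psi_term p (Psi_series p) j k))"
      using vge_of_int_dvd[OF C[of k j]] by (simp add: vge_p_power_mult)
    then have "vge (real (M * k) - real C + real k * w)
        (of_int (psi_term p (Psi_series p) j k) * x ^ k)"
      using w by (intro vge_mult vge_power_real)
    moreover have "real k * 1 \<le> real k * (real M + w)"
      using M by (intro mult_left_mono) auto
    ultimately show ?thesis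
      by (elim vge_mono) (simp add: algebra_simps)
  qed
  then show ?thesis
    by blast
qed

lemma eventually_vge_linear:
  assumes "\<And>k. vge (real k - C) (f k)"
  shows "eventually (\<lambda>k. vge r (f k)) sequentially"
proof -
  obtain N where N: "r + C \<le> real N"
    using real_arch_simple by blast
  show ?thesis
    using eventually_ge_at_top[of N] by eventually_elim (use N in \<open>auto intro: vge_mono[OF assms]\<close>)
qed

text \<open>The bound at \<open>j = 0\<close> makes the series converge, so the definite description
  in \<open>Psi\<close> denotes its limit.\<close>

lemma vlim_Psi: "vlim (\<lambda>n. \<Sum>k<n. of_int (fps_nth (Psi_series p) k) * x ^ k) (Psi p v x)"
proof -
  obtain C where C: "\<And>j k. vge (real k - C) (of_int (psi_term p (Psi_series p) j k) * x ^ k)"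
    using vge_psi_term by blast
  obtain l where l: "vlim (\<lambda>n. \<Sum>k<n. of_int (fps_nth (Psi_series p) k) * x ^ k) l"
    using vlim_summable[OF eventually_vge_linear[OF C[of _ 0]]] by auto
  then have "Psi p v x = l"
    unfolding Psi_def limitin_iff_vlim by (blast intro: vlim_unique)
  with l show ?thesis
    by simp
qed

lemma vlim_psi_term:
  "vlim (\<lambda>n. \<Sum>k<n. of_int (psi_term p (Psi_series p) j k) * x ^ k)
     (Psi p v (of_nat p ^ j * x) ^ (p ^ j) / of_nat p ^ j)"
proof -
  let ?y = "of_nat p ^ j * x"
  obtain C where C: "\<And>j k. vge (real k - C) (of_int (psi_term p (Psi_series p) j k) * ?y ^ k)"
    using vge_psi_term by blast
  have "vlim (\<lambda>n. \<Sum>k<n. of_int (fps_nth (Psi_series p ^ (p ^ j)) k) * ?y ^ k)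
      (Psi p v ?y ^ (p ^ j))"
    by (rule vlim_fps_power[OF vlim_Psi C[of _ 0, unfolded psi_term_0_left]])
  then have "vlim (\<lambda>n. inverse (of_nat p ^ j) *
      (\<Sum>k<n. of_int (fps_nth (Psi_series p ^ (p ^ j)) k) * ?y ^ k))
      (inverse (of_nat p ^ j) * Psi p v ?y ^ (p ^ j))"
    by (intro vlim_mult vlim_const)
  then show ?thesis
    unfolding psi_term_eq[OF p_gt_1 Psi_series_nth_0]
    by (simp add: sum_distrib_left divide_inverse mult_ac)
qed

text \<open>The sums over \<open>j\<close> and \<open>k\<close> may be interchanged because the
  tails in \<open>k\<close> are small uniformly in \<open>j\<close>. On the finite range of
  \<open>k\<close> that is left, the formal identity leaves only the linear term
  \<open>x\<close>.\<close>

lemma Psi_functional_equation: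
  "vlim (\<lambda>J. \<Sum>j<J. Psi p v (of_nat p ^ j * x) ^ (p ^ j) / of_nat p ^ j) x"
  unfolding vlim_def
proof
  fix r
  let ?G = "\<lambda>j. Psi p v (of_nat p ^ j * x) ^ (p ^ j) / of_nat p ^ j"
  let ?g = "\<lambda>j k. of_int (psi_term p (Psi_series p) j k) * x ^ k"
  obtain C where C: "\<And>j k. vge (real k - C) (?g j k)"
    using vge_psi_term by blast
  obtain N' where N': "r + C \<le> real N'"
    using real_arch_simple by blast
  \<comment> \<open>\<open>N'\<close> makes all terms with \<open>k \<ge> N\<close> vanish modulo
    \<open>p ^ r\<close>; adding 2 ensures that the index 1 lies below \<open>N\<close>.\<close>
  define N where "N = N' + 2"
  have tail: "vge r (?G j - (\<Sum>k<N. ?g j k))" for j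
  proof (rule vlim_vge)
    show "vlim (\<lambda>n. (\<Sum>k<n. ?g j k) - (\<Sum>k<N. ?g j k)) (?G j - (\<Sum>k<N. ?g j k))"
      by (intro vlim_diff vlim_psi_term vlim_const)
    show "eventually (\<lambda>n. vge r ((\<Sum>k<n. ?g j k) - (\<Sum>k<N. ?g j k))) sequentially"
      using eventually_ge_at_top[of N]
    proof eventually_elim
      case (elim n)
      have "(\<Sum>k<n. ?g j k) - (\<Sum>k<N. ?g j k) = (\<Sum>k\<in>{..<n} - {..<N}. ?g j k)"
        using elim by (intro sum_diff[symmetric]) auto
      also have "vge r \<dots>"
        using N' by (intro vge_sum vge_mono[OF C]) (auto simp: N_def)
      finally show ?case .
    qed
  qed
  show "eventually (\<lambda>J. vge r ((\<Sum>j<J. ?G j) - x)) sequentially"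
    using eventually_ge_at_top[of N]
  proof eventually_elim
    case (elim J)
    have "(\<Sum>j<J. \<Sum>k<N. ?g j k) = (\<Sum>k<N. of_int (\<Sum>j<J. psi_term p (Psi_series p) j k) * x ^ k)"
      by (subst sum.swap) (simp add: sum_distrib_right)
    also have "\<dots> = (\<Sum>k<N. of_int (of_bool (k = 1)) * x ^ k)"
      using elim by (intro sum.cong) (simp_all add: sum_psi_term)
    also have "\<dots> = (\<Sum>k\<in>{1}. of_int (of_bool (k = 1)) * x ^ k)"
      by (rule sum.mono_neutral_right) (auto simp: N_def)
    finally have "(\<Sum>j<J. ?G j) - x = (\<Sum>j<J. ?G j - (\<Sum>k<N. ?g j k))"
      by (simp add: sum_subtractf)
    then show ?case
      using tail by (simp add: vge_sum)
  qed
qed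

section \<open>Integrality and the Lipschitz bound on Qp\<close>

lemma Psi_in_Qp: "x \<in> Qp p v \<Longrightarrow> Psi p v x \<in> Qp p v"
  by (rule Qp_vlim[OF vlim_Psi]) (intro Qp_sum Qp_mult Qp_power Rats_subset_Qp[of "of_int _"] Rats_of_int)

text \<open>The coefficients are integers, and at integral points \<open>x - y\<close> divides every
  \<open>x ^ k - y ^ k\<close> with integral quotient.\<close>

lemma vge_Psi_diff_integral:
  assumes "vge 0 x" "vge 0 y" "vge r (x - y)"
  shows "vge r (Psi p v x - Psi p v y)"
proof (rule vlim_vge)
  show "vlim (\<lambda>n. (\<Sum>k<n. of_int (fps_nth (Psi_series p) k) * x ^ k)
      - (\<Sum>k<n. of_int (fps_nth (Psi_series p) k) * y ^ k)) (Psi p v x - Psi p v y)"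
    by (intro vlim_diff vlim_Psi)
  have "vge r ((\<Sum>k<n. of_int (fps_nth (Psi_series p) k) * x ^ k)
      - (\<Sum>k<n. of_int (fps_nth (Psi_series p) k) * y ^ k))" for n
    unfolding sum_subtractf[symmetric] right_diff_distrib[symmetric]
    using assms by (intro vge_sum vge_mult_left vge_of_int vge_power_diff)
  then show "eventually (\<lambda>n. vge r ((\<Sum>k<n. of_int (fps_nth (Psi_series p) k) * x ^ k)
      - (\<Sum>k<n. of_int (fps_nth (Psi_series p) k) * y ^ k))) sequentially"
    by simp
qed

lemma vge_Psi_of_integral:
  assumes "vge 0 x"
  shows "vge 0 (Psi p v x)"
proof (rule vlim_vge[OF vlim_Psi])
  show "eventually (\<lambda>n. vge 0 (\<Sum>k<n. of_int (fps_nth (Psi_series p) k) * x ^ k)) sequentially"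
    using assms by (intro always_eventually allI vge_sum vge_mult_left vge_of_int vge_power)
qed

lemma ex_p_power_integral: "\<exists>N. vge 0 (of_nat p ^ N * x)"
proof -
  obtain r where r: "vge r x"
    using ex_vge by blast
  obtain N where "- r \<le> real N"
    using real_arch_simple by blast
  then have "vge 0 (of_nat p ^ N * x)"
    unfolding vge_p_power_mult using vge_mono[OF r] by simp
  then show ?thesis ..
qed

lemma vlim_Psi_by_multiples:
  "vlim (\<lambda>J. \<Sum>j<J. (Psi p v (of_nat p ^ Suc j * x) ^ (p ^ j)
      - Psi p v (of_nat p ^ Suc j * x) ^ (p ^ Suc j)) / of_nat p ^ Suc j) (Psi p v x)"
proof -
  let ?d = "\<lambda>j. Psi p v (of_nat p ^ j * x)"
  have p0: "of_nat p \<noteq> (0::'a)"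
    using p_gt_1 by simp
  have "vlim (\<lambda>J. inverse (of_nat p) *
      (\<Sum>j<J. Psi p v (of_nat p ^ j * (of_nat p * x)) ^ (p ^ j) / of_nat p ^ j))
      (inverse (of_nat p) * (of_nat p * x))"
    by (intro vlim_mult vlim_const Psi_functional_equation)
  then have 1: "vlim (\<lambda>J. \<Sum>j<J. ?d (Suc j) ^ (p ^ j) / of_nat p ^ Suc j) x"
    using p0 by (simp add: sum_distrib_left divide_inverse mult_ac)
  have "vlim (\<lambda>J. \<Sum>j<Suc J. ?d j ^ (p ^ j) / of_nat p ^ j) x"
    using Psi_functional_equation by (rule vlim_Suc)
  then have 2: "vlim (\<lambda>J. ?d 0 + (\<Sum>j<J. ?d (Suc j) ^ (p ^ Suc j) / of_nat p ^ Suc j)) x"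
    by (simp only: sum.lessThan_Suc_shift) simp
  show ?thesis
    \<comment> \<open>In the limit this is \<open>x - (x - ?d 0) = ?d 0\<close>, and
      \<open>?d 0\<close> is the value at \<open>x\<close>.\<close>
    using vlim_diff[OF 1 vlim_diff[OF 2 vlim_const[of "?d 0"]]]
    by (simp add: sum_subtractf diff_divide_distrib)
qed

lemma vge_Psi_Qp:
  assumes "x \<in> Qp p v"
  shows "vge 0 (Psi p v x)"
proof -
  obtain N where "vge 0 (of_nat p ^ N * x)"
    using ex_p_power_integral by blast
  then show ?thesis
    using assms
  proof (induction N arbitrary: x)
    case 0
    then show ?case
      by (simp add: vge_Psi_of_integral)
  next
    case (Suc N)
    have d: "vge 0 (Psi p v (of_nat p ^ Suc j * x))" "of_nat p ^ Suc j * x \<in> Qp p v" for j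
    proof -
      show Q: "of_nat p ^ Suc j * x \<in> Qp p v"
        using Suc.prems by (intro Qp_mult Rats_subset_Qp[of "of_nat p ^ Suc j"]) simp_all
      \<comment> \<open>Regrouped, this says that \<open>p ^ N\<close> already makes
        \<open>p ^ Suc j * x\<close> integral, as the induction hypothesis demands.\<close>
      have "vge 0 (of_nat p ^ j * (of_nat p ^ Suc N * x))"
        by (rule vge_mult_left[OF vge_power[OF vge_of_nat] Suc.prems(1)])
      then show "vge 0 (Psi p v (of_nat p ^ Suc j * x))"
        using Q by (intro Suc.IH) (simp add: mult_ac)
    qed
    show ?case
    proof (rule vlim_vge[OF vlim_Psi_by_multiples], intro always_eventually allI vge_sum)
      fix j
      show "vge 0 ((Psi p v (of_nat p ^ Suc j * x) ^ (p ^ j)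
        - Psi p v (of_nat p ^ Suc j * x) ^ (p ^ Suc j)) / of_nat p ^ Suc j)"
        \<comment> \<open>The denominator requires precision \<open>Suc j\<close> of the numerator,
          exactly what the Fermat congruence supplies up to sign.\<close>
        unfolding vge_divide_p_power
        using vge_Qp_power_p_power[OF Psi_in_Qp[OF d(2)] d(1)]
        by (subst vge_minus_commute) simp
    qed
  qed
qed

lemma vge_Psi_diff:
  assumes "x \<in> Qp p v" "vge r (y - x)" "0 \<le> r"
  shows "vge r (Psi p v y - Psi p v x)"
proof -
  obtain N where "vge 0 (of_nat p ^ N * x)"
    using ex_p_power_integral by blast
  then show ?thesis
    using assms
  proof (induction N arbitrary: x y r)
    case 0
    then have "vge 0 (y - x + x)"
      using vge_mono by (intro vge_add) auto
    with 0 show ?case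
      by (intro vge_Psi_diff_integral) auto
  next
    case (Suc N)
    let ?d = "\<lambda>x j. Psi p v (of_nat p ^ j * x)"
    let ?D = "\<lambda>j. ?d y j ^ (p ^ j) / of_nat p ^ j - ?d x j ^ (p ^ j) / of_nat p ^ j"
    have diff: "vge r (?D (Suc j))" for j
    proof -
      have Q: "of_nat p ^ Suc j * x \<in> Qp p v"
        using Suc.prems by (intro Qp_mult Rats_subset_Qp[of "of_nat p ^ Suc j"]) simp_all
      have "vge 0 (of_nat p ^ j * (of_nat p ^ Suc N * x))"
        by (rule vge_mult_left[OF vge_power[OF vge_of_nat] Suc.prems(1)])
      then have "vge 0 (of_nat p ^ N * (of_nat p ^ Suc j * x))"
        by (simp add: mult_ac)
      moreover have "vge (r + real (Suc j)) (of_nat p ^ Suc j * y - of_nat p ^ Suc j * x)"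
        unfolding right_diff_distrib[symmetric] vge_p_power_mult using Suc.prems by simp
      ultimately have IH: "vge (r + real (Suc j)) (?d y (Suc j) - ?d x (Suc j))"
        using Suc.prems Q by (intro Suc.IH) simp_all
      have x: "vge 0 (?d x (Suc j))"
        using Q by (rule vge_Psi_Qp)
      \<comment> \<open>Only \<open>x\<close> is known to lie in \<open>Qp p v\<close>; integrality
        at \<open>y\<close> is inherited from \<open>x\<close> through the congruence
        \<open>IH\<close>.\<close>
      have "vge 0 (?d y (Suc j) - ?d x (Suc j) + ?d x (Suc j))"
        using Suc.prems by (intro vge_add x vge_mono[OF IH]) auto
      then show ?thesis
        \<comment> \<open>Powers of integral elements keep the precision \<open>r + Suc j\<close>,
          and division by \<open>p ^ Suc j\<close> leaves \<open>r\<close>.\<close>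
        unfolding diff_divide_distrib[symmetric] vge_divide_p_power
        using x IH by (intro vge_power_diff) auto
    qed
    have "vlim (\<lambda>J. (\<Sum>j<J. ?d y j ^ (p ^ j) / of_nat p ^ j) - (\<Sum>j<J. ?d x j ^ (p ^ j) / of_nat p ^ j)
        - ?D 0) (y - x - ?D 0)"
      by (intro vlim_diff Psi_functional_equation vlim_const)
    moreover have "eventually (\<lambda>J. vge r ((\<Sum>j<J. ?d y j ^ (p ^ j) / of_nat p ^ j)
        - (\<Sum>j<J. ?d x j ^ (p ^ j) / of_nat p ^ j) - ?D 0)) sequentially"
      using eventually_gt_at_top[of 0]
    proof eventually_elim
      case (elim J)
      then obtain K where "J = Suc K"
        by (cases J) auto
      then show ?case
        unfolding sum_subtractf[symmetric] using diff
        by (simp only: sum.lessThan_Suc_shift add_diff_cancel_left') (intro vge_sum)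
    qed
    ultimately have "vge r (y - x - ?D 0)"
      by (rule vlim_vge)
    \<comment> \<open>Both \<open>y - x\<close> and the limit of the terms with positive index
      vanish modulo \<open>p ^ r\<close>; their difference is \<open>?D 0\<close>.\<close>
    with Suc.prems(3) have "vge r (y - x - (y - x - ?D 0))"
      by (rule vge_diff)
    then show ?case
      by simp
  qed
qed

section \<open>Cosets as balls and uniform continuity\<close>

lemma val_ring_iff: "z \<in> val_ring v \<longleftrightarrow> vge 0 z"
  by (simp add: val_ring_def vge_def zero_ereal_def)

lemma p_power_coset:
  "y \<in> {x + of_nat p ^ j * z | z. z \<in> val_ring v} \<longleftrightarrow> vge (real j) (y - x)"
proof
  assume "vge (real j) (y - x)"
  then have "(y - x) / of_nat p ^ j \<in> val_ring v"
    by (simp add: val_ring_iff vge_divide_p_power)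
  moreover have "y = x + of_nat p ^ j * ((y - x) / of_nat p ^ j)"
    using p_gt_1 by simp
  ultimately show "y \<in> {x + of_nat p ^ j * z | z. z \<in> val_ring v}"
    by blast
qed (auto simp: val_ring_iff vge_p_power_mult)

lemma uniformly_continuous_Psi:
  "uniformly_continuous_map
     (submetric (padic_metric p v) (Qp p v)) (submetric (padic_metric p v) (Zp p v)) (Psi p v)"
proof -
  have "Psi p v \<in> Qp p v \<rightarrow> Zp p v"
    by (auto simp: Zp_def val_ring_iff intro: Psi_in_Qp vge_Psi_Qp)
  moreover have "\<exists>\<delta>>0. \<forall>x\<in>Qp p v. \<forall>y\<in>Qp p v. padic_dist p v y x < \<delta>
      \<longrightarrow> padic_dist p v (Psi p v y) (Psi p v x) < e" if e: "0 < e" for e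
  proof -
    \<comment> \<open>The Lipschitz constant is 1, so the radius \<open>p powr (- k)\<close> chosen
      below \<open>e\<close> also serves as \<delta>.\<close>
    obtain k where k: "real p powr (- real k) < e"
      using ex_powr_less[OF e] by blast
    have "padic_dist p v (Psi p v y) (Psi p v x) < e"
      if "x \<in> Qp p v" "padic_dist p v y x < real p powr (- real k)" for x y
    proof -
      have "vge (real k) (y - x)"
        using that(2) by (simp flip: padic_dist_le_iff)
      then have "padic_dist p v (Psi p v y) (Psi p v x) \<le> real p powr (- real k)"
        unfolding padic_dist_le_iff using that(1) by (intro vge_Psi_diff) auto
      with k show ?thesis
        by simp
    qed
    then show ?thesis
      using p_gt_1 by (intro exI[of _ "real p powr (- real k)"]) auto
  qed
  ultimately show ?thesis
    by (simp add: uniformly_continuous_map_def padic_metric_def)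
qed

end

theorem proposition0p1:
  fixes p :: nat and v :: "'a::field_char_0 \<Rightarrow> ereal"
  assumes "prime p" and "is_Cp p v"
  shows "uniformly_continuous_map
           (submetric (padic_metric p v) (Qp p v)) (submetric (padic_metric p v) (Zp p v)) (Psi p v) \<and>
         (\<forall>j::nat. \<forall>x\<in>Qp p v.
            Psi p v ` {x + of_nat p ^ j * z | z. z \<in> val_ring v}
              \<subseteq> {Psi p v x + of_nat p ^ j * z | z. z \<in> val_ring v})"
proof -
  interpret padic_valued p v
    using assms by unfold_locales (auto simp: is_Cp_def)
  show ?thesis
  proof (intro conjI allI ballI image_subsetI)
    show "Psi p v y \<in> {Psi p v x + of_nat p ^ j * z | z. z \<in> val_ring v}"
      if "x \<in> Qp p v" "y \<in> {x + of_nat p ^ j * z | z. z \<in> val_ring v}" for x y and j :: nat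
      using that unfolding p_power_coset by (intro vge_Psi_diff) auto
  qed (rule uniformly_continuous_Psi)
qed

end
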